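(* Let $\mathcal H$ be a real Hilbert space, $C\subseteq\mathcal H$ nonempty closed convex, and let $B\colon\mathcal H\to\mathcal H$ be $L$-Lipschitz ($L>0$) and $\sigma$-strongly monotone for some $\sigma>0$, with $S=\{z\}$ nonempty. Let $0<\lambda_0\le\min\{\tfrac1{5L},\tfrac1{32\sigma}\}$, $\lambda_{\min}\in(0,\lambda_0)$, and let $(\lambda_k)_{k\ge0}$ satisfy $\lambda_{\min}\le\lambda_k\le\lambda_0$ for all $k$ and $\sum_k|\lambda_k-\lambda_{k-1}|<\infty$. Let $0\le\beta_k\le\tfrac14$, $\sum_k\beta_k<\infty$, $\theta_k=1-\beta_k$, $x_{-1}=x_0=u_0\in C$, and define $$x_{k+1}=P_C\bigl(x_k-\lambda_kB(u_k)\bigr)\quad(k\ge0),\qquad u_k=x_k+\theta_k(x_k-x_{k-1})+\beta_k(x_k-u_{k-1})\quad(k\ge1).$$ Suppose the step size stabilizes: $\lambda_k=\lambda_\infty$ for all $k\ge K$. Then, with $\rho=1-\lambda_\infty\sigma$, $$\|x_k-z\|^2\le c\,\rho^{\,k-K}\qquad(k\ge K)$$ for a finite constant $c$ depending on $a_K$ and $\sum_k\beta_k$.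
   Context: $P_C$ is the metric projection onto $C$. $B$ is $\sigma$-strongly monotone if $\langle B(x)-B(y),x-y\rangle\ge\sigma\|x-y\|^2$ for all $x,y\in\mathcal H$. The solution set is $S=\{z\in C:\langle B(z),x-z\rangle\ge0\ \forall x\in C\}$. Convention: $\lambda_{-1}=\lambda_0$, $u_{-1}=x_0$. Here $a_K$ is the value at $k=K$ of the Lyapunov sequence $a_k=\|x_k-z\|^2+\tfrac73\lambda_{k-1}L\|x_k-u_{k-1}\|^2+2\lambda_{k-1}\langle B(z),x_{k-1}-z\rangle+\tfrac13\|u_{k-1}-x_{k-1}\|^2$. *)

theory Defs
  imports "HOL-Analysis.Analysis"
begin

(* The library's closest_point requires heine_borel, which excludes infinite-dimensional
   Hilbert spaces.  For closed convex C \<noteq> {} in a Hilbert space the minimiser exists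
   and is unique, so the choice below is determined. *)
definition metric_proj :: "'a::real_inner set \<Rightarrow> 'a \<Rightarrow> 'a" where
  "metric_proj C x = (SOME p. p \<in> C \<and> (\<forall>y\<in>C. norm (x - p) \<le> norm (x - y)))"

definition strongly_monotone :: "real \<Rightarrow> ('a::real_inner \<Rightarrow> 'a) \<Rightarrow> bool" where
  "strongly_monotone \<sigma> B \<longleftrightarrow> (\<forall>x y. inner (B x - B y) (x - y) \<ge> \<sigma> * (norm (x - y))\<^sup>2)"

definition VI_solutions :: "'a::real_inner set \<Rightarrow> ('a \<Rightarrow> 'a) \<Rightarrow> 'a set" where
  "VI_solutions C B = {z \<in> C. \<forall>x\<in>C. inner (B z) (x - z) \<ge> 0}"

(* The shifted sequence k \<mapsto> s (k - 1), where s0 is the value at index -1. *)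
definition lag :: "'b \<Rightarrow> (nat \<Rightarrow> 'b) \<Rightarrow> nat \<Rightarrow> 'b" where
  "lag s0 s k = (case k of 0 \<Rightarrow> s0 | Suc j \<Rightarrow> s j)"

(* Conventions at index -1: lam takes the value lam 0; both x and u take the value x 0. *)
definition lyapunov ::
  "('a::real_inner \<Rightarrow> 'a) \<Rightarrow> real \<Rightarrow> 'a \<Rightarrow> (nat \<Rightarrow> real) \<Rightarrow> (nat \<Rightarrow> 'a) \<Rightarrow> (nat \<Rightarrow> 'a) \<Rightarrow> nat \<Rightarrow> real"
  where
  "lyapunov B L z lam x u k =
     (norm (x k - z))\<^sup>2
     + 7 / 3 * lag (lam 0) lam k * L * (norm (x k - lag (x 0) u k))\<^sup>2
     + 2 * lag (lam 0) lam k * inner (B z) (lag (x 0) x k - z)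
     + 1 / 3 * (norm (lag (x 0) u k - lag (x 0) x k))\<^sup>2"

end

theory Submission
  imports Defs
begin

text \<open>
  For a constant step size \<open>\<gamma>\<close> the modified energy
  \<open>A\<^sub>k = \<parallel>x\<^sub>k - z\<parallel>\<^sup>2 + 7/3 \<gamma> L \<parallel>x\<^sub>k - u\<^sub>k\<^sub>-\<^sub>1\<parallel>\<^sup>2 + 3 \<gamma> \<langle>B z, x\<^sub>k\<^sub>-\<^sub>1 - z\<rangle> + \<parallel>u\<^sub>k\<^sub>-\<^sub>1 - x\<^sub>k\<^sub>-\<^sub>1\<parallel>\<^sup>2/12\<close>
  satisfies \<open>A\<^sub>k\<^sub>+\<^sub>1 \<le> (\<rho> + 300 \<beta>\<^sub>k) A\<^sub>k\<close>.  The weight 3 in place of the 2 of the Lyapunov sequence is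
  what lets the term \<open>\<langle>B z, x\<^sub>k\<^sub>-\<^sub>1 - z\<rangle>\<close> contract as well.  The summable \<open>\<beta>\<^sub>k\<close> only cost a factor
  \<open>exp (310 (\<Sum>k. \<beta>\<^sub>k))\<close>.

  The recursion is started at \<open>K + 2\<close>: the step size just before \<open>K\<close> may be arbitrarily small
  compared with \<open>\<lambda>\<^sub>\<infinity>\<close>, so the energy at \<open>K + 1\<close> is not controlled by \<open>a\<^sub>K\<close>, whereas the variational
  inequality of the projection bounds the energy at \<open>K + 2\<close> by a universal multiple of \<open>a\<^sub>K\<close>.
\<close>

section \<open>The metric projection\<close>

text \<open>Completeness takes the place of compactness: the sets of points of \<open>C\<close>
  whose distance to \<open>x\<close> nearly attains the infimum are closed, nested and of diameter
  tending to 0, so they have a common point.\<close>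

lemma metric_proj_exists:
  fixes C :: "'a::{real_inner,complete_space} set"
  assumes "C \<noteq> {}" "closed C" "convex C"
  shows "\<exists>p\<in>C. \<forall>y\<in>C. norm (x - p) \<le> norm (x - y)"
proof -
  define d where "d = infdist x C"
  have d0: "0 \<le> d" and dle: "\<And>y. y \<in> C \<Longrightarrow> d \<le> norm (x - y)"
    by (auto simp: d_def infdist_nonneg infdist_le dist_norm[symmetric])
  define r where "r n = sqrt (d\<^sup>2 + 1 / real (Suc n))" for n
  have r2: "(r n)\<^sup>2 = d\<^sup>2 + 1 / real (Suc n)" for n
    by (simp add: r_def)
  define S where "S n = C \<inter> cball x (r n)" for n
  have "\<And>n. closed (S n)"
    using assms by (auto simp: S_def)
  moreover have "S n \<noteq> {}" for n
  proof -
    have "d < r n"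
      unfolding r_def by (rule real_less_rsqrt) simp
    then obtain y where "y \<in> C" "dist x y < r n"
      using assms(1) infdist_notempty[of C x] cINF_less_iff[of C "dist x" "r n"]
      by (auto simp: d_def)
    then show ?thesis
      by (auto simp: S_def)
  qed
  moreover have "S n \<subseteq> S m" if "m \<le> n" for m n
  proof -
    have "1 / real (Suc n) \<le> 1 / real (Suc m)"
      using that by (intro divide_left_mono) auto
    then have "r n \<le> r m"
      unfolding r_def by (intro real_sqrt_le_mono add_left_mono)
    then show ?thesis
      by (auto simp: S_def)
  qed
  moreover have "\<exists>n. \<forall>a\<in>S n. \<forall>b\<in>S n. dist a b < e" if "e > 0" for e
  proof -
    obtain n where n: "4 / e\<^sup>2 < real n"
      using reals_Archimedean2 by blast
    have n': "4 / real (Suc n) < e\<^sup>2"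
      using n that by (simp add: field_simps) (smt (verit) zero_less_power2)
    have "dist a b < e" if ab: "a \<in> S n" "b \<in> S n" for a b
    proof -
      \<comment> \<open>The midpoint lies in \<open>C\<close>, hence at distance at least
        \<open>d\<close> from \<open>x\<close>. The parallelogram law then gives
        \<open>(dist a b)\<^sup>2 \<le> 4 / real (Suc n)\<close>, because the squared radius exceeds
        \<open>d\<^sup>2\<close> by \<open>1 / real (Suc n)\<close>.\<close>
      have "(1 / 2) *\<^sub>R a + (1 / 2) *\<^sub>R b \<in> C"
        using ab assms(3) by (intro convexD) (auto simp: S_def)
      then have "d\<^sup>2 \<le> (norm (x - ((1 / 2) *\<^sub>R a + (1 / 2) *\<^sub>R b)))\<^sup>2"
        using d0 dle by (intro power_mono) auto
      moreover have "(norm (a - b))\<^sup>2 = 2 * (norm (x - a))\<^sup>2 + 2 * (norm (x - b))\<^sup>2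
          - 4 * (norm (x - ((1 / 2) *\<^sub>R a + (1 / 2) *\<^sub>R b)))\<^sup>2"
        by (simp add: power2_norm_eq_inner inner_simps inner_commute algebra_simps)
      moreover have "(norm (x - a))\<^sup>2 \<le> (r n)\<^sup>2" "(norm (x - b))\<^sup>2 \<le> (r n)\<^sup>2"
        using ab by (auto simp: S_def dist_norm intro!: power_mono)
      ultimately have "(dist a b)\<^sup>2 < e\<^sup>2"
        using r2[of n] n' by (simp add: dist_norm)
      then show ?thesis
        by (rule power2_less_imp_less) (use \<open>e > 0\<close> in simp)
    qed
    then show ?thesis by blast
  qed
  ultimately obtain a where a: "\<And>n. a \<in> S n"
    using decreasing_closed_nest[of S] by metis
  have "(norm (x - a))\<^sup>2 \<le> d\<^sup>2 + 1 / real (Suc n)" for n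
    using a[of n] power_mono[of "norm (x - a)" "r n" 2] by (simp add: S_def dist_norm r2)
  moreover have "(\<lambda>n. d\<^sup>2 + 1 / real (Suc n)) \<longlonglongrightarrow> d\<^sup>2 + 0"
    by (intro tendsto_add tendsto_const LIMSEQ_Suc[OF lim_1_over_n])
  ultimately have "(norm (x - a))\<^sup>2 \<le> d\<^sup>2"
    by (intro LIMSEQ_le_const[where X = "\<lambda>n. d\<^sup>2 + 1 / real (Suc n)"]) auto
  then have "norm (x - a) \<le> d"
    using d0 by (rule power2_le_imp_le)
  then show ?thesis
    using a[of 0] dle by (force simp: S_def)
qed

text \<open>Existence justifies the choice in \<open>metric_proj\<close>; minimality over a convex
  set gives the obtuse-angle inequality, the form in which the projection enters every later
  estimate.\<close>

lemma metric_proj: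
  fixes C :: "'a::{real_inner,complete_space} set"
  assumes "C \<noteq> {}" "closed C" "convex C"
  shows metric_proj_in: "metric_proj C x \<in> C"
    and metric_proj_inner_le:
      "y \<in> C \<Longrightarrow> inner (x - metric_proj C x) (y - metric_proj C x) \<le> 0"
proof -
  have *: "metric_proj C x \<in> C \<and> (\<forall>y\<in>C. norm (x - metric_proj C x) \<le> norm (x - y))"
    unfolding metric_proj_def by (rule someI_ex) (use metric_proj_exists[OF assms] in blast)
  then show "metric_proj C x \<in> C" by blast
  show "inner (x - metric_proj C x) (y - metric_proj C x) \<le> 0" if "y \<in> C"
    using * that assms by (intro any_closest_point_dot[of C]) (auto simp: dist_norm)
qed

section \<open>One step with constant step size\<close>

text \<open>
  Below \<open>w, x, y\<close> are consecutive iterates and \<open>v, u\<close> the extrapolated points belonging to \<open>w, x\<close>.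
  Since \<open>\<theta>\<^sub>k = 1 - \<beta>\<^sub>k\<close>, the extrapolation rule reads \<open>u = 2 x - w + \<beta> (w - v)\<close>.
\<close>

lemma reflected_step_inequality:
  fixes x y w u v z Bu Bv Bz :: "'a::real_inner"
  assumes u: "u = 2 *\<^sub>R x - w + \<beta> *\<^sub>R (w - v)"
    and \<beta>: "\<beta> \<le> 1" and \<gamma>: "0 \<le> \<gamma>"
    and proj_z: "inner (x - \<gamma> *\<^sub>R Bu - y) (z - y) \<le> 0"
    and proj_y: "inner (w - \<gamma> *\<^sub>R Bv - x) (y - x) \<le> 0"
    and proj_w: "inner (w - \<gamma> *\<^sub>R Bv - x) (w - x) \<le> 0"
    and mono: "\<sigma> * (norm (u - z))\<^sup>2 \<le> inner (Bu - Bz) (u - z)"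
  shows "(norm (y - z))\<^sup>2 + (norm (y - u))\<^sup>2 \<le> (norm (x - z))\<^sup>2 + (norm (u - x))\<^sup>2
     - 2 * (1 - \<beta>) * (norm (x - w))\<^sup>2 - 2 * \<gamma> * \<sigma> * (norm (u - z))\<^sup>2
     - 2 * \<gamma> * (2 - \<beta>) * inner Bz (x - z) + 2 * \<gamma> * (1 - \<beta>) * inner Bz (w - z)
     + 2 * \<gamma> * \<beta> * inner (Bv - Bz) (x - v) + 2 * \<gamma> * inner (Bu - Bv) (u - y)
     + 2 * \<beta> * inner (v - w) (y - x)"
proof -
  \<comment> \<open>An exact identity. The weights 1 and \<open>1 - \<beta>\<close> of the last two
    projection inequalities give the test direction \<open>(y - x) + (1 - \<beta>) *\<^sub>R (w - x)
    = (y - u) + \<beta> *\<^sub>R (x - v)\<close>, so that \<open>Bv\<close> occurs only in the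
    differences \<open>Bu - Bv\<close> and \<open>Bv - Bz\<close>.\<close>
  have "(norm (x - z))\<^sup>2 + (norm (u - x))\<^sup>2
     - 2 * (1 - \<beta>) * (norm (x - w))\<^sup>2 - 2 * \<gamma> * inner (Bu - Bz) (u - z)
     - 2 * \<gamma> * (2 - \<beta>) * inner Bz (x - z) + 2 * \<gamma> * (1 - \<beta>) * inner Bz (w - z)
     + 2 * \<gamma> * \<beta> * inner (Bv - Bz) (x - v) + 2 * \<gamma> * inner (Bu - Bv) (u - y)
     + 2 * \<beta> * inner (v - w) (y - x) - (norm (y - z))\<^sup>2 - (norm (y - u))\<^sup>2
    = - 2 * inner (x - \<gamma> *\<^sub>R Bu - y) (z - y) - 2 * inner (w - \<gamma> *\<^sub>R Bv - x) (y - x)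
      - 2 * (1 - \<beta>) * inner (w - \<gamma> *\<^sub>R Bv - x) (w - x)"
    unfolding power2_norm_eq_inner u
    by (simp add: inner_simps inner_commute algebra_simps)
  moreover have "2 * (1 - \<beta>) * inner (w - \<gamma> *\<^sub>R Bv - x) (w - x) \<le> 0"
    using \<beta> proj_w by (intro mult_nonneg_nonpos) auto
  moreover have "2 * \<gamma> * \<sigma> * (norm (u - z))\<^sup>2 \<le> 2 * \<gamma> * inner (Bu - Bz) (u - z)"
    using mult_left_mono[OF mono \<gamma>] by simp
  ultimately show ?thesis
    using proj_z proj_y by linarith
qed

lemma scaled_inner_le:
  fixes a b p q :: "'a::real_inner"
  assumes "norm (a - b) \<le> L * norm (p - q)" "0 \<le> \<gamma>"
  shows "\<bar>\<gamma> * inner (a - b) c\<bar> \<le> \<gamma> * L * (norm (p - q) * norm c)"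
proof -
  have "\<bar>\<gamma> * inner (a - b) c\<bar> \<le> \<gamma> * (norm (a - b) * norm c)"
    using assms(2) by (simp add: abs_mult Cauchy_Schwarz_ineq2 mult_left_mono)
  also have "\<dots> \<le> \<gamma> * (L * norm (p - q) * norm c)"
    using assms by (intro mult_left_mono mult_right_mono) auto
  finally show ?thesis by (simp add: mult.assoc)
qed

text \<open>
  Abstracts distances: \<open>X = \<parallel>x - z\<parallel>\<close>, \<open>Y = \<parallel>y - z\<parallel>\<close>, \<open>D = \<parallel>u - x\<parallel>\<close>, \<open>E = \<parallel>y - u\<parallel>\<close>,
  \<open>F = \<parallel>x - v\<parallel>\<close>, \<open>Q = \<parallel>v - w\<parallel>\<close>, with \<open>t = \<gamma> L\<close> and \<open>s = \<gamma> \<sigma>\<close>.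
\<close>

lemma step_contraction_real:
  fixes \<beta> s t X Y D E F Q P2 U2 g h :: real
  assumes \<beta>: "0 \<le> \<beta>" "\<beta> \<le> 1 / 4" and t: "0 \<le> t" "t \<le> 1 / 5" and s: "0 \<le> s" "s \<le> 1 / 32"
    and nonneg: "0 \<le> X" "0 \<le> D" "0 \<le> E" "0 \<le> F" "0 \<le> Q" "0 \<le> g" "0 \<le> h"
    and P2: "D\<^sup>2 - 2 * \<beta> * (D * Q) \<le> P2" and U2: "X\<^sup>2 \<le> 2 * U2 + 2 * D\<^sup>2"
    and step: "Y\<^sup>2 + E\<^sup>2 \<le> X\<^sup>2 + D\<^sup>2 - 2 * (1 - \<beta>) * P2 - 2 * s * U2
      - 2 * (2 - \<beta>) * g + 2 * (1 - \<beta>) * h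
      + 2 * \<beta> * (t * ((X + F) * F)) + 2 * (t * ((D + F) * E)) + 2 * \<beta> * (Q * (E + D))"
  shows "Y\<^sup>2 + 7 / 3 * t * E\<^sup>2 + 3 * g + D\<^sup>2 / 12
    \<le> (1 - s + 300 * \<beta>) * (X\<^sup>2 + 7 / 3 * t * F\<^sup>2 + 3 * h + Q\<^sup>2 / 12)"
proof -
  have DQ: "0 \<le> \<beta> * (D * Q)" using \<beta> nonneg by simp
  have young: "2 * (a * b) \<le> c * a\<^sup>2 + b\<^sup>2 / c" if "c > 0" for a b c :: real
    using zero_le_power2[of "c * a - b"] that by (simp add: field_simps power2_eq_square)
  have b2: "\<beta> * a \<le> a / 4" if "0 \<le> a" for a
    using mult_right_mono[OF \<beta>(2) that] by simp
  have "(1 - \<beta>) * (D\<^sup>2 - 2 * \<beta> * (D * Q)) \<le> (1 - \<beta>) * P2"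
    using \<beta> by (intro mult_left_mono[OF P2]) simp
  moreover have "\<beta> * D\<^sup>2 \<le> D\<^sup>2 / 4" "0 \<le> \<beta> * (\<beta> * (D * Q))"
    using b2[of "D\<^sup>2"] \<beta> DQ by auto
  ultimately have e1: "- 2 * (1 - \<beta>) * P2 \<le> - (3 / 2) * D\<^sup>2 + 4 * (\<beta> * (D * Q))"
    by (simp add: algebra_simps)
  \<comment> \<open>The contraction of \<open>X\<^sup>2\<close>: strong monotonicity acts at
    \<open>u\<close>, and moving it to \<open>x\<close> costs only a small share of
    \<open>D\<^sup>2\<close>.\<close>
  have "s * X\<^sup>2 \<le> s * (2 * U2 + 2 * D\<^sup>2)"
    by (intro mult_left_mono[OF U2] s)
  moreover have "s * D\<^sup>2 \<le> 1 / 32 * D\<^sup>2"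
    by (intro mult_right_mono s) simp
  ultimately have e2: "- 2 * s * U2 \<le> - (s * X\<^sup>2) + D\<^sup>2 / 16"
    by (simp add: algebra_simps)
  have e3: "- 2 * (2 - \<beta>) * g \<le> - 3 * g" "2 * (1 - \<beta>) * h \<le> 2 * h"
    using b2[of g] \<beta> nonneg by (auto simp: algebra_simps)
  have tX: "t * X\<^sup>2 \<le> 1 / 5 * X\<^sup>2" and tE: "t * E\<^sup>2 \<le> 1 / 5 * E\<^sup>2"
    and tDE: "t * (D * E) \<le> 1 / 5 * (D * E)"
    using nonneg by (intro mult_right_mono t; simp)+
  have "t * (2 * (X * F)) \<le> t * (1 * X\<^sup>2 + F\<^sup>2 / 1)"
    by (intro mult_left_mono[OF young] t) simp
  then have "2 * (t * ((X + F) * F)) \<le> X\<^sup>2 / 5 + 3 * (t * F\<^sup>2)"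
    using tX by (simp add: algebra_simps power2_eq_square)
  from mult_left_mono[OF this \<beta>(1)]
  have e4: "2 * \<beta> * (t * ((X + F) * F)) \<le> \<beta> * X\<^sup>2 / 5 + 3 * (\<beta> * (t * F\<^sup>2))"
    by (simp add: algebra_simps)
  have "t * (2 * (F * E)) \<le> t * (2 * F\<^sup>2 + E\<^sup>2 / 2)"
    by (intro mult_left_mono[OF young] t) simp
  moreover have "2 * (D * E) \<le> 1 * D\<^sup>2 + E\<^sup>2 / 1"
    by (rule young) simp
  ultimately have e5: "2 * (t * ((D + F) * E)) \<le> D\<^sup>2 / 5 + E\<^sup>2 * (3 / 10) + 2 * (t * F\<^sup>2)"
    using tE tDE by (simp add: algebra_simps)
  have "2 * (D * Q) \<le> 1 / 8 * D\<^sup>2 + Q\<^sup>2 / (1 / 8)"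
    by (rule young) simp
  from mult_left_mono[OF this \<beta>(1)]
  have e6: "4 * (\<beta> * (D * Q)) \<le> D\<^sup>2 / 16 + 16 * (\<beta> * Q\<^sup>2)"
    using b2[of "D\<^sup>2"] by (simp add: algebra_simps)
  have "2 * (D * Q) \<le> 1 / 4 * D\<^sup>2 + Q\<^sup>2 / (1 / 4)" "2 * (E * Q) \<le> 1 / 2 * E\<^sup>2 + Q\<^sup>2 / (1 / 2)"
    by (rule young; simp)+
  from this[THEN mult_left_mono[OF _ \<beta>(1)]]
  have e7: "2 * \<beta> * (Q * (E + D)) \<le> D\<^sup>2 / 16 + E\<^sup>2 / 8 + 6 * (\<beta> * Q\<^sup>2)"
    using b2[of "D\<^sup>2"] b2[of "E\<^sup>2"] by (simp add: algebra_simps)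
  have sF: "s * (t * F\<^sup>2) \<le> 1 / 32 * (t * F\<^sup>2)" and sh: "s * h \<le> 1 / 32 * h"
    and sQ: "s * Q\<^sup>2 \<le> 1 / 32 * Q\<^sup>2"
    using t nonneg by (intro mult_right_mono s; simp)+
  have pos: "0 \<le> \<beta> * X\<^sup>2" "0 \<le> \<beta> * (t * F\<^sup>2)" "0 \<le> \<beta> * h" "0 \<le> \<beta> * Q\<^sup>2" "0 \<le> t * F\<^sup>2"
    "0 \<le> D\<^sup>2" "0 \<le> E\<^sup>2" "0 \<le> Q\<^sup>2"
    using \<beta> t nonneg by auto
  \<comment> \<open>The budget closes: moved to one side, \<open>D\<^sup>2\<close> has coefficient
    -1/2 + 3/16 + 1/5 + 1/12 < 0, and \<open>E\<^sup>2\<close> is covered since 3/10 + 1/8 + 7/15 <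
    1.\<close>
  have "Y\<^sup>2 + 7 / 3 * t * E\<^sup>2 + 3 * g + D\<^sup>2 / 12
    \<le> X\<^sup>2 - s * X\<^sup>2 + 2 * (t * F\<^sup>2) + 2 * h
      + \<beta> * X\<^sup>2 / 5 + 3 * (\<beta> * (t * F\<^sup>2)) + 22 * (\<beta> * Q\<^sup>2)"
    using step e1 e2 e3 e4 e5 e6 e7 tE pos by linarith
  also have "\<dots> \<le> (1 - s + 300 * \<beta>) * (X\<^sup>2 + 7 / 3 * t * F\<^sup>2 + 3 * h + Q\<^sup>2 / 12)"
  proof -
    \<comment> \<open>Compare term by term, with \<open>1 - s\<close> at least 31/32: 7/3 and 3
      times 31/32 both exceed 2. The constant 300 is dictated by \<open>Q\<^sup>2\<close>, whose
      weight 1/12 turns it into 25, against the required 22.\<close>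
    have "(1 - s + 300 * \<beta>) * (X\<^sup>2 + 7 / 3 * t * F\<^sup>2 + 3 * h + Q\<^sup>2 / 12)
      = X\<^sup>2 - s * X\<^sup>2 + 300 * (\<beta> * X\<^sup>2)
        + 7 / 3 * (t * F\<^sup>2) - 7 / 3 * (s * (t * F\<^sup>2)) + 700 * (\<beta> * (t * F\<^sup>2))
        + 3 * h - 3 * (s * h) + 900 * (\<beta> * h)
        + 1 / 12 * Q\<^sup>2 - 1 / 12 * (s * Q\<^sup>2) + 25 * (\<beta> * Q\<^sup>2)"
      by (simp add: field_simps)
    then show ?thesis
      using sF sh sQ pos nonneg by linarith
  qed
  finally show ?thesis .
qed

text \<open>The arguments \<open>x\<close>, \<open>w\<close>, \<open>v\<close> stand for the current
  iterate, the previous iterate and its extrapolated point. The weight 1/12 fits into the share 9/80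
  of \<open>D\<^sup>2\<close> that the other estimates in \<open>step_contraction_real\<close> leave
  over; the 1/3 of \<open>lyapunov\<close> would not.\<close>

definition energy :: "'a::real_inner \<Rightarrow> 'a \<Rightarrow> real \<Rightarrow> real \<Rightarrow> 'a \<Rightarrow> 'a \<Rightarrow> 'a \<Rightarrow> real" where
  "energy z Bz L \<gamma> x w v = (norm (x - z))\<^sup>2 + 7 / 3 * (\<gamma> * L) * (norm (x - v))\<^sup>2
     + 3 * (\<gamma> * inner Bz (w - z)) + (norm (v - w))\<^sup>2 / 12"

text \<open>Lipschitz, Cauchy-Schwarz and triangle inequalities reduce
  \<open>reflected_step_inequality\<close> to the scalar statement
  \<open>step_contraction_real\<close>.\<close>

lemma energy_step:
  fixes x y w u v z :: "'a::real_inner" and B :: "'a \<Rightarrow> 'a"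
  assumes u: "u = 2 *\<^sub>R x - w + \<beta> *\<^sub>R (w - v)"
    and \<beta>: "0 \<le> \<beta>" "\<beta> \<le> 1 / 4" and \<gamma>: "0 \<le> \<gamma>" and L: "0 \<le> L" "\<gamma> * L \<le> 1 / 5"
    and \<sigma>: "0 \<le> \<sigma>" "\<gamma> * \<sigma> \<le> 1 / 32"
    and lip: "\<And>a b. norm (B a - B b) \<le> L * norm (a - b)"
    and proj_z: "inner (x - \<gamma> *\<^sub>R B u - y) (z - y) \<le> 0"
    and proj_y: "inner (w - \<gamma> *\<^sub>R B v - x) (y - x) \<le> 0"
    and proj_w: "inner (w - \<gamma> *\<^sub>R B v - x) (w - x) \<le> 0"
    and mono: "\<sigma> * (norm (u - z))\<^sup>2 \<le> inner (B u - B z) (u - z)"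
    and sol: "0 \<le> inner (B z) (x - z)" "0 \<le> inner (B z) (w - z)"
  shows "energy z (B z) L \<gamma> y x u \<le> (1 - \<gamma> * \<sigma> + 300 * \<beta>) * energy z (B z) L \<gamma> x w v"
proof -
  have t0: "0 \<le> \<gamma> * L" and s0: "0 \<le> \<gamma> * \<sigma>"
    using \<gamma> L \<sigma> by auto
  have "\<gamma> * inner (B v - B z) (x - v) \<le> \<gamma> * L * (norm (v - z) * norm (x - v))"
    using scaled_inner_le[OF lip \<gamma>, of v z "x - v"] by linarith
  also have "\<dots> \<le> \<gamma> * L * ((norm (x - z) + norm (x - v)) * norm (x - v))"
    using norm_triangle_ineq4[of "x - z" "x - v"] t0
    by (intro mult_left_mono mult_right_mono) auto
  finally have "\<beta> * (\<gamma> * inner (B v - B z) (x - v))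
      \<le> \<beta> * (\<gamma> * L * ((norm (x - z) + norm (x - v)) * norm (x - v)))"
    using \<beta> by (intro mult_left_mono)
  moreover have "2 * \<gamma> * \<beta> * inner (B v - B z) (x - v) = 2 * (\<beta> * (\<gamma> * inner (B v - B z) (x - v)))"
    by simp
  ultimately have e1: "2 * \<gamma> * \<beta> * inner (B v - B z) (x - v)
      \<le> 2 * \<beta> * (\<gamma> * L * ((norm (x - z) + norm (x - v)) * norm (x - v)))"
    by linarith
  have "\<gamma> * inner (B u - B v) (u - y) \<le> \<gamma> * L * (norm (u - v) * norm (y - u))"
    using scaled_inner_le[OF lip \<gamma>, of u v "u - y"] by (simp add: norm_minus_commute)
  also have "\<dots> \<le> \<gamma> * L * ((norm (u - x) + norm (x - v)) * norm (y - u))"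
    using norm_triangle_ineq[of "u - x" "x - v"] t0
    by (intro mult_left_mono mult_right_mono) auto
  finally have e2: "2 * \<gamma> * inner (B u - B v) (u - y)
      \<le> 2 * (\<gamma> * L * ((norm (u - x) + norm (x - v)) * norm (y - u)))"
    by simp
  have "inner (v - w) (y - x) \<le> norm (v - w) * norm (y - x)"
    by (rule norm_cauchy_schwarz)
  also have "\<dots> \<le> norm (v - w) * (norm (y - u) + norm (u - x))"
    using norm_triangle_ineq[of "y - u" "u - x"] by (intro mult_left_mono) auto
  finally have e3: "2 * \<beta> * inner (v - w) (y - x)
      \<le> 2 * \<beta> * (norm (v - w) * (norm (y - u) + norm (u - x)))"
    using \<beta> by (simp add: mult_left_mono)
  have "x - w = (u - x) + \<beta> *\<^sub>R (v - w)"
    by (simp add: u scaleR_2 algebra_simps)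
  then have "(norm (x - w))\<^sup>2 = (norm (u - x))\<^sup>2 + 2 * \<beta> * inner (u - x) (v - w)
      + (\<beta> * norm (v - w))\<^sup>2"
    by (simp add: power2_norm_eq_inner power_mult_distrib inner_add inner_commute)
       (simp add: power2_eq_square)
  moreover have "\<beta> * (- (norm (u - x) * norm (v - w))) \<le> \<beta> * inner (u - x) (v - w)"
    using Cauchy_Schwarz_ineq2[of "u - x" "v - w"] \<beta> by (intro mult_left_mono) linarith+
  ultimately have P2: "(norm (u - x))\<^sup>2 - 2 * \<beta> * (norm (u - x) * norm (v - w)) \<le> (norm (x - w))\<^sup>2"
    using zero_le_power2[of "\<beta> * norm (v - w)"] by linarith
  \<comment> \<open>Parallelogram law for \<open>u - z\<close> and \<open>u - x\<close>, whose
    difference is \<open>x - z\<close>.\<close>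
  have "(norm (x - z))\<^sup>2 + (norm ((u - z) + (u - x)))\<^sup>2 = 2 * (norm (u - z))\<^sup>2 + 2 * (norm (u - x))\<^sup>2"
    by (simp add: power2_norm_eq_inner inner_simps inner_commute)
  then have U2: "(norm (x - z))\<^sup>2 \<le> 2 * (norm (u - z))\<^sup>2 + 2 * (norm (u - x))\<^sup>2"
    using zero_le_power2[of "norm ((u - z) + (u - x))"] by linarith
  show ?thesis
    unfolding energy_def
    by (rule step_contraction_real[OF \<beta> t0 L(2) s0 \<sigma>(2) _ _ _ _ _ _ _ P2 U2])
       (use reflected_step_inequality[OF u _ \<gamma> proj_z proj_y proj_w mono] \<beta> \<gamma> sol e1 e2 e3
         in \<open>auto simp: mult_ac\<close>)
qed

section \<open>The first two steps after the step size has stabilized\<close>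

text \<open>Test the projection inequality at \<open>z\<close> and split \<open>B u\<close> as
  \<open>(B u - B z) + B z\<close>. The \<open>B z\<close> part has a favourable sign, the rest is
  Lipschitz, and a factor \<open>norm (y - z)\<close> cancels.\<close>

lemma projected_step_dist:
  fixes x y u z :: "'a::real_inner"
  assumes "0 \<le> \<gamma>" "\<gamma> * L \<le> 1 / 5" and lip: "\<And>a b. norm (B a - B b) \<le> L * norm (a - b)"
    and proj_z: "inner (x - \<gamma> *\<^sub>R B u - y) (z - y) \<le> 0" and sol: "0 \<le> inner (B z) (y - z)"
  shows "norm (y - z) \<le> norm (x - z) + norm (u - z) / 5"
proof -
  have "inner (x - \<gamma> *\<^sub>R B u - y) (z - y)
    = (norm (y - z))\<^sup>2 - inner (x - z) (y - z) + \<gamma> * inner (B u - B z) (y - z)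
      + \<gamma> * inner (B z) (y - z)"
    by (simp add: power2_norm_eq_inner inner_simps inner_commute algebra_simps)
  moreover have "\<bar>\<gamma> * inner (B u - B z) (y - z)\<bar> \<le> \<gamma> * L * (norm (u - z) * norm (y - z))"
    by (rule scaled_inner_le[OF lip assms(1)])
  moreover have "\<gamma> * L * (norm (u - z) * norm (y - z)) \<le> 1 / 5 * (norm (u - z) * norm (y - z))"
    using assms(2) by (intro mult_right_mono) auto
  moreover have "inner (x - z) (y - z) \<le> norm (x - z) * norm (y - z)"
    by (rule norm_cauchy_schwarz)
  moreover have "0 \<le> \<gamma> * inner (B z) (y - z)"
    using assms by simp
  ultimately have "(norm (y - z))\<^sup>2 \<le> (norm (x - z) + norm (u - z) / 5) * norm (y - z)"
    using proj_z by (simp add: algebra_simps)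
  then show ?thesis
    by (cases "norm (y - z) = 0") (auto simp: power2_eq_square)
qed

text \<open>This bound is uniform in the earlier step size \<open>\<mu>\<close>, although
  \<open>\<mu>\<close> may be tiny. Testing the inequality for \<open>x\<close> at \<open>w\<close>
  yields a quadratic inequality for \<open>d\<close> that fails beyond \<open>2 * R\<close>.\<close>

lemma previous_iterate_close:
  fixes x w v z :: "'a::real_inner"
  assumes "0 \<le> \<mu>" "\<mu> * L \<le> 1 / 5" and lip: "\<And>a b. norm (B a - B b) \<le> L * norm (a - b)"
    and proj_w: "inner (w - \<mu> *\<^sub>R B v - x) (w - x) \<le> 0" and sol: "0 \<le> inner (B z) (x - z)"
    and R: "0 \<le> R" "norm (x - z) \<le> R" "norm (v - w) \<le> 2 * R" "\<mu> * inner (B z) (w - z) \<le> R\<^sup>2 / 2"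
  shows "norm (x - w) \<le> 2 * R"
proof (rule ccontr)
  define d where "d = norm (x - w)"
  assume "\<not> norm (x - w) \<le> 2 * R"
  then have d: "2 * R < d" by (simp add: d_def)
  have "inner (w - \<mu> *\<^sub>R B v - x) (w - x)
    = d\<^sup>2 - \<mu> * inner (B z) (w - z) + \<mu> * inner (B z) (x - z) - \<mu> * inner (B v - B z) (w - x)"
    by (simp add: d_def power2_norm_eq_inner inner_simps inner_commute algebra_simps)
  moreover have "\<bar>\<mu> * inner (B v - B z) (w - x)\<bar> \<le> \<mu> * L * (norm (v - z) * norm (w - x))"
    by (rule scaled_inner_le[OF lip assms(1)])
  moreover have "\<mu> * L * (norm (v - z) * norm (w - x)) \<le> 1 / 5 * (norm (v - z) * norm (w - x))"
    using assms(2) by (intro mult_right_mono) auto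
  moreover have "norm (v - z) * norm (w - x) \<le> (3 * R + d) * d"
    using norm_triangle_ineq[of "v - w" "w - z"] norm_triangle_ineq[of "w - x" "x - z"] R
    by (intro mult_mono) (auto simp: d_def norm_minus_commute)
  moreover have "0 \<le> \<mu> * inner (B z) (x - z)"
    using assms by simp
  ultimately have "d\<^sup>2 \<le> R\<^sup>2 / 2 + (3 * R + d) * d / 5"
    using proj_w R by linarith
  moreover have "(3 * R + d) * d / 5 = 3 / 5 * (R * d) + 1 / 5 * (d * d)"
    by (simp add: field_simps)
  \<comment> \<open>With \<open>R * d \<le> d * d / 2\<close> and
    \<open>R * R \<le> d * d / 4\<close> the right-hand side is at most 5/8 of
    \<open>d * d\<close>.\<close>
  moreover have "2 * (R * d) \<le> d * d" "2 * (R * R) \<le> R * d"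
    using mult_right_mono[of "2 * R" d d] mult_left_mono[of "2 * R" d R] d R by simp_all
  moreover have "0 < d * d"
    using d R by (intro mult_pos_pos) auto
  ultimately show False
    unfolding power2_eq_square by linarith
qed

text \<open>All distances arising in the two steps are bounded by multiples of \<open>R\<close>,
  starting from \<open>previous_iterate_close\<close>; in the application \<open>R\<^sup>2\<close>
  is the Lyapunov value at \<open>K\<close>.\<close>

lemma energy_restart:
  fixes x x' x'' u u' w v z :: "'a::real_inner" and B :: "'a \<Rightarrow> 'a"
  assumes \<gamma>: "0 \<le> \<gamma>" "\<gamma> * L \<le> 1 / 5" "0 \<le> L" and \<mu>: "0 \<le> \<mu>" "\<mu> * L \<le> 1 / 5"
    and lip: "\<And>a b. norm (B a - B b) \<le> L * norm (a - b)"
    and \<beta>: "0 \<le> \<beta>" "\<beta> \<le> 1 / 4" "0 \<le> \<beta>'" "\<beta>' \<le> 1 / 4"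
    and u: "u = 2 *\<^sub>R x - w + \<beta> *\<^sub>R (w - v)" and u': "u' = 2 *\<^sub>R x' - x + \<beta>' *\<^sub>R (x - u)"
    and proj_w: "inner (w - \<mu> *\<^sub>R B v - x) (w - x) \<le> 0"
    and proj1: "inner (x - \<gamma> *\<^sub>R B u - x') (z - x') \<le> 0"
    and proj2: "inner (x' - \<gamma> *\<^sub>R B u' - x'') (z - x'') \<le> 0"
    and sol: "0 \<le> inner (B z) (x - z)" "0 \<le> inner (B z) (x' - z)" "0 \<le> inner (B z) (x'' - z)"
    and R: "0 \<le> R" "norm (x - z) \<le> R" "norm (v - w) \<le> 2 * R" "\<mu> * inner (B z) (w - z) \<le> R\<^sup>2 / 2"
  shows "norm (x' - z) \<le> 2 * R" and "energy z (B z) L \<gamma> x'' x' u' \<le> 103 * R\<^sup>2"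
proof -
  have scale: "norm (b *\<^sub>R a) \<le> norm a / 4" if "0 \<le> b" "b \<le> 1 / 4" for b and a :: 'a
    using that mult_right_mono[of b "1/4" "norm a"] by simp
  have d: "norm (x - w) \<le> 2 * R"
    by (rule previous_iterate_close[OF \<mu> lip proj_w sol(1) R])
  have "u - z = ((x - z) + (x - w)) + \<beta> *\<^sub>R (w - v)"
    by (simp add: u scaleR_2)
  then have "norm (u - z) \<le> norm (x - z) + norm (x - w) + norm (\<beta> *\<^sub>R (w - v))"
    using norm_triangle_ineq[of "(x - z) + (x - w)" "\<beta> *\<^sub>R (w - v)"]
      norm_triangle_ineq[of "x - z" "x - w"] by (simp only:)
  then have uz: "norm (u - z) \<le> 4 * R"
    using scale[OF \<beta>(1,2), of "w - v"] d R by (simp add: norm_minus_commute)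
  show x': "norm (x' - z) \<le> 2 * R"
    using projected_step_dist[OF \<gamma>(1,2) lip proj1 sol(2)] uz R by simp
  have x1x: "norm (x' - x) \<le> 3 * R" and xu: "norm (x - u) \<le> 5 * R"
    using norm_triangle_ineq4[of "x' - z" "x - z"] norm_triangle_ineq4[of "x - z" "u - z"] x' uz R
    by simp_all
  have u1x1: "norm (u' - x') \<le> 5 * R"
    using norm_triangle_ineq[of "x' - x" "\<beta>' *\<^sub>R (x - u)"] scale[OF \<beta>(3,4), of "x - u"] x1x xu R
    by (simp add: u' scaleR_2 algebra_simps)
  then have u1z: "norm (u' - z) \<le> 7 * R"
    using norm_triangle_ineq[of "u' - x'" "x' - z"] x' by simp
  have x'': "norm (x'' - z) \<le> 4 * R"
    using projected_step_dist[OF \<gamma>(1,2) lip proj2 sol(3)] u1z x' R by simp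
  have x2u1: "norm (x'' - u') \<le> 11 * R"
    using norm_triangle_ineq4[of "x'' - z" "u' - z"] x'' u1z by simp
  have sq: "a\<^sup>2 \<le> c\<^sup>2 * R\<^sup>2" if "0 \<le> a" "a \<le> c * R" for a c
    using power_mono[OF that(2,1), of 2] by (simp add: power_mult_distrib)
  \<comment> \<open>The size of \<open>B z\<close> is not controlled by \<open>R\<close>, so the
    bound on \<open>\<gamma> * inner (B z) (x' - z)\<close> is read off the projection inequality
    for \<open>x'\<close>, which carries the same \<open>\<gamma>\<close>.\<close>
  have "inner (x - \<gamma> *\<^sub>R B u - x') (z - x')
    = - inner (x - x') (x' - z) + \<gamma> * inner (B u - B z) (x' - z) + \<gamma> * inner (B z) (x' - z)"
    by (simp add: inner_simps inner_commute algebra_simps)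
  moreover have "\<bar>\<gamma> * inner (B u - B z) (x' - z)\<bar> \<le> \<gamma> * L * (norm (u - z) * norm (x' - z))"
    by (rule scaled_inner_le[OF lip \<gamma>(1)])
  moreover have "\<gamma> * L * (norm (u - z) * norm (x' - z)) \<le> 1 / 5 * ((4 * R) * (2 * R))"
    using \<gamma> uz x' R by (intro mult_mono) auto
  moreover have "inner (x - x') (x' - z) \<le> (3 * R) * (2 * R)"
    using norm_cauchy_schwarz[of "x - x'" "x' - z"]
      mult_mono[OF x1x x'] R by (simp add: norm_minus_commute)
  ultimately have g: "\<gamma> * inner (B z) (x' - z) \<le> 38 / 5 * R\<^sup>2"
    using proj1 by (simp add: power2_eq_square)
  have "\<gamma> * L * (norm (x'' - u'))\<^sup>2 \<le> 1 / 5 * (121 * R\<^sup>2)"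
    using \<gamma> sq[OF _ x2u1] by (intro mult_mono) auto
  moreover have "(norm (x'' - z))\<^sup>2 \<le> 16 * R\<^sup>2" "(norm (u' - x'))\<^sup>2 \<le> 25 * R\<^sup>2"
    using sq[OF _ x''] sq[OF _ u1x1] by simp_all
  ultimately show "energy z (B z) L \<gamma> x'' x' u' \<le> 103 * R\<^sup>2"
    using g zero_le_power2[of R] unfolding energy_def by linarith
qed

section \<open>Linear convergence\<close>

text \<open>Since 310 times 31/32 exceeds 300, each factor is at most
  \<open>\<rho> * (1 + 310 * \<beta> n)\<close>, and \<open>1 + t \<le> exp t\<close> turns the
  product into an exponential of the sum.\<close>

lemma perturbed_geometric_decay:
  fixes A \<beta> :: "nat \<Rightarrow> real"
  assumes \<rho>: "31 / 32 \<le> \<rho>" and \<beta>: "\<And>n. 0 \<le> \<beta> n" and A: "\<And>n. 0 \<le> A n"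
    and step: "\<And>n. A (Suc n) \<le> (\<rho> + 300 * \<beta> n) * A n"
  shows "A n \<le> A 0 * exp (310 * (\<Sum>i<n. \<beta> i)) * \<rho> ^ n"
proof (induction n)
  case (Suc n)
  have "31 / 32 * \<beta> n \<le> \<rho> * \<beta> n"
    by (intro mult_right_mono \<rho> \<beta>)
  then have "\<rho> + 300 * \<beta> n \<le> \<rho> * (1 + 310 * \<beta> n)"
    using \<beta>[of n] by (simp add: algebra_simps)
  also have "\<dots> \<le> \<rho> * exp (310 * \<beta> n)"
    using \<rho> by (intro mult_left_mono exp_ge_add_one_self) auto
  finally have "(\<rho> + 300 * \<beta> n) * A n
      \<le> (\<rho> * exp (310 * \<beta> n)) * (A 0 * exp (310 * (\<Sum>i<n. \<beta> i)) * \<rho> ^ n)"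
    using Suc A[of n] \<rho> by (intro mult_mono) auto
  also have "\<dots> = A 0 * exp (310 * (\<Sum>i<Suc n. \<beta> i)) * \<rho> ^ Suc n"
    by (simp add: exp_add algebra_simps)
  finally show ?case
    using step[of n] by linarith
qed simp

theorem corollary7p4:
  shows "\<exists>c :: real \<Rightarrow> real \<Rightarrow> real.
    \<forall>(C :: 'a::{real_inner,complete_space} set) (B :: 'a \<Rightarrow> 'a) (L :: real) (\<sigma> :: real) (z :: 'a)
      (lam_min :: real) (lam :: nat \<Rightarrow> real) (\<beta> :: nat \<Rightarrow> real) (\<theta> :: nat \<Rightarrow> real)
      (x :: nat \<Rightarrow> 'a) (u :: nat \<Rightarrow> 'a) (K :: nat) (lam_inf :: real).
      C \<noteq> {} \<longrightarrow> closed C \<longrightarrow> convex C \<longrightarrow>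
      0 < L \<longrightarrow> L-lipschitz_on UNIV B \<longrightarrow>
      0 < \<sigma> \<longrightarrow> strongly_monotone \<sigma> B \<longrightarrow>
      VI_solutions C B = {z} \<longrightarrow>
      0 < lam 0 \<longrightarrow> lam 0 \<le> min (1 / (5 * L)) (1 / (32 * \<sigma>)) \<longrightarrow>
      0 < lam_min \<longrightarrow> lam_min < lam 0 \<longrightarrow>
      (\<forall>k. lam_min \<le> lam k \<and> lam k \<le> lam 0) \<longrightarrow>
      summable (\<lambda>k. \<bar>lam k - lag (lam 0) lam k\<bar>) \<longrightarrow>
      (\<forall>k. 0 \<le> \<beta> k \<and> \<beta> k \<le> 1 / 4) \<longrightarrow> summable \<beta> \<longrightarrow>
      (\<forall>k. \<theta> k = 1 - \<beta> k) \<longrightarrow>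
      x 0 \<in> C \<longrightarrow> u 0 = x 0 \<longrightarrow>
      (\<forall>k. x (k + 1) = metric_proj C (x k - lam k *\<^sub>R B (u k))) \<longrightarrow>
      (\<forall>k\<ge>1. u k = x k + \<theta> k *\<^sub>R (x k - x (k - 1)) + \<beta> k *\<^sub>R (x k - u (k - 1))) \<longrightarrow>
      (\<forall>k\<ge>K. lam k = lam_inf) \<longrightarrow>
      (\<forall>k\<ge>K. (norm (x k - z))\<^sup>2
                \<le> c (lyapunov B L z lam x u K) (\<Sum>k. \<beta> k) * (1 - lam_inf * \<sigma>) ^ (k - K))"
proof (intro exI[of _ "\<lambda>a s. 200 * a * exp (310 * s)"] allI impI)
  fix C :: "'a set" and B :: "'a \<Rightarrow> 'a" and L \<sigma> :: real and z :: 'a and lam_min :: real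
    and lam \<beta> \<theta> :: "nat \<Rightarrow> real" and x u :: "nat \<Rightarrow> 'a" and K k :: nat and lam_inf :: real
  assume C: "C \<noteq> {}" "closed C" "convex C" and L: "0 < L" and lipB: "L-lipschitz_on UNIV B"
    and \<sigma>: "0 < \<sigma>" "strongly_monotone \<sigma> B" and S: "VI_solutions C B = {z}"
    and lam0: "0 < lam 0" "lam 0 \<le> min (1 / (5 * L)) (1 / (32 * \<sigma>))"
    and lam_min: "0 < lam_min" and lam: "\<forall>k. lam_min \<le> lam k \<and> lam k \<le> lam 0"
    and \<beta>: "\<forall>k. 0 \<le> \<beta> k \<and> \<beta> k \<le> 1 / 4" "summable \<beta>" and \<theta>: "\<forall>k. \<theta> k = 1 - \<beta> k"
    and x0: "x 0 \<in> C" and u0: "u 0 = x 0"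
    and x_step: "\<forall>k. x (k + 1) = metric_proj C (x k - lam k *\<^sub>R B (u k))"
    and u_step: "\<forall>k\<ge>1. u k = x k + \<theta> k *\<^sub>R (x k - x (k - 1)) + \<beta> k *\<^sub>R (x k - u (k - 1))"
    and stable: "\<forall>k\<ge>K. lam k = lam_inf" and kK: "K \<le> k"
  have lip: "norm (B a - B b) \<le> L * norm (a - b)" for a b
    using lipschitz_onD[OF lipB, of a b] by (simp add: dist_norm)
  have sol: "0 \<le> inner (B z) (y - z)" if "y \<in> C" for y
    using S that unfolding VI_solutions_def by auto
  have zC: "z \<in> C"
    using S unfolding VI_solutions_def by auto
  have xC: "x j \<in> C" for j
    using x0 x_step metric_proj_in[OF C] by (cases j) auto
  have proj: "inner (x j - lam j *\<^sub>R B (u j) - x (Suc j)) (y - x (Suc j)) \<le> 0" if "y \<in> C" for j y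
    using metric_proj_inner_le[OF C that, of "x j - lam j *\<^sub>R B (u j)"] x_step by simp
  have u_Suc: "u (Suc j) = 2 *\<^sub>R x (Suc j) - x j + \<beta> (Suc j) *\<^sub>R (x j - u j)" for j
    using u_step[rule_format, of "Suc j"] \<theta> by (simp add: scaleR_2 algebra_simps)
  have lam_pos: "0 < lam j" and lamL: "lam j * L \<le> 1 / 5" and lam\<sigma>: "lam j * \<sigma> \<le> 1 / 32" for j
  proof -
    show "0 < lam j"
      using lam lam_min by (meson less_le_trans)
    have "lam j \<le> 1 / (5 * L)" "lam j \<le> 1 / (32 * \<sigma>)"
      using lam lam0 by (meson min.boundedE order_trans)+
    then show "lam j * L \<le> 1 / 5" "lam j * \<sigma> \<le> 1 / 32"
      using L \<sigma> by (auto simp: field_simps)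
  qed
  \<comment> \<open>The data at index \<open>K - 1\<close>. For \<open>K = 0\<close> they are
    \<open>x 0\<close>, \<open>x 0\<close> and \<open>lam 0\<close>: then \<open>uK\<close> reduces
    to \<open>u 0 = x 0\<close>, and \<open>proj_w\<close> is trivial because
    \<open>w = x K\<close>.\<close>
  define w v \<mu> where "w = lag (x 0) x K" and "v = lag (x 0) u K" and "\<mu> = lag (lam 0) lam K"
  define a where "a = lyapunov B L z lam x u K"
  define R where "R = sqrt a"
  have \<mu>: "0 < \<mu>" "\<mu> * L \<le> 1 / 5" and wC: "w \<in> C"
    using lam_pos lamL xC by (auto simp: \<mu>_def w_def lag_def split: nat.split)
  have uK: "u K = 2 *\<^sub>R x K - w + \<beta> K *\<^sub>R (w - v)"
    using u0 u_Suc by (cases K) (simp_all add: w_def v_def lag_def scaleR_2)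
  have proj_w: "inner (w - \<mu> *\<^sub>R B v - x K) (w - x K) \<le> 0"
    using proj[OF xC] by (cases K) (simp_all add: w_def v_def \<mu>_def lag_def)
  have a: "a = (norm (x K - z))\<^sup>2 + 7 / 3 * (\<mu> * L * (norm (x K - v))\<^sup>2)
      + 2 * (\<mu> * inner (B z) (w - z)) + 1 / 3 * (norm (v - w))\<^sup>2"
    by (simp add: a_def lyapunov_def w_def v_def \<mu>_def)
  have a_terms: "0 \<le> \<mu> * L * (norm (x K - v))\<^sup>2" "0 \<le> \<mu> * inner (B z) (w - z)"
    using \<mu> L sol[OF wC] by auto
  have a0: "0 \<le> a"
    unfolding a using a_terms by simp
  then have R: "0 \<le> R" "R\<^sup>2 = a"
    by (simp_all add: R_def)
  have sq_le: "(norm (x K - z))\<^sup>2 \<le> a" "(norm (v - w))\<^sup>2 \<le> 4 * a"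
    and R\<mu>: "\<mu> * inner (B z) (w - z) \<le> R\<^sup>2 / 2"
    unfolding R(2)
    using a a_terms zero_le_power2[of "norm (x K - z)"] zero_le_power2[of "norm (v - w)"]
    by linarith+
  have Rx: "norm (x K - z) \<le> R" and Rv: "norm (v - w) \<le> 2 * R"
    using power2_le_imp_le[of "norm (x K - z)" R] power2_le_imp_le[of "norm (v - w)" "2 * R"] sq_le R
    by (simp_all add: power_mult_distrib)
  have lam_eq: "lam (K + n) = lam_inf" for n
    using stable by simp
  \<comment> \<open>\<open>A n\<close> is the energy at index \<open>K + n + 2\<close>, so both
    iterates in it come from steps of size \<open>lam_inf\<close>.\<close>
  define A where "A n = energy z (B z) L lam_inf (x (K + n + 2)) (x (K + n + 1)) (u (K + n + 1))" for n
  have inf: "0 < lam_inf" "lam_inf * L \<le> 1 / 5" "lam_inf * \<sigma> \<le> 1 / 32"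
    using lam_pos[of K] lamL[of K] lam\<sigma>[of K] lam_eq[of 0] by auto
  have proj': "inner (x (K + n) - lam_inf *\<^sub>R B (u (K + n)) - x (K + n + 1)) (y - x (K + n + 1)) \<le> 0"
    if "y \<in> C" for n y
    using proj[OF that, of "K + n"] lam_eq[of n] by simp
  have u1: "u (K + 1) = 2 *\<^sub>R x (K + 1) - x K + \<beta> (K + 1) *\<^sub>R (x K - u K)"
    using u_Suc[of K] by simp
  have proj1: "inner (x K - lam_inf *\<^sub>R B (u K) - x (K + 1)) (z - x (K + 1)) \<le> 0"
    and proj2: "inner (x (K + 1) - lam_inf *\<^sub>R B (u (K + 1)) - x (K + 2)) (z - x (K + 2)) \<le> 0"
    using proj'[OF zC, of 0] proj'[OF zC, of 1] by simp_all
  have \<beta>0: "0 \<le> \<beta> j" and \<beta>4: "\<beta> j \<le> 1 / 4" for j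
    using \<beta>(1) by auto
  note restart = energy_restart[OF less_imp_le[OF inf(1)] inf(2) less_imp_le[OF L]
      less_imp_le[OF \<mu>(1)] \<mu>(2) lip \<beta>0 \<beta>4 \<beta>0 \<beta>4 uK u1 proj_w proj1 proj2
      sol[OF xC] sol[OF xC] sol[OF xC] R(1) Rx Rv R\<mu>]
  have x1: "norm (x (K + 1) - z) \<le> 2 * R" and A0: "A 0 \<le> 103 * a"
    using restart R(2) by (simp_all add: A_def)
  define \<rho> where "\<rho> = 1 - lam_inf * \<sigma>"
  have \<rho>: "31 / 32 \<le> \<rho>"
    using inf by (simp add: \<rho>_def)
  have A_step: "A (Suc n) \<le> (\<rho> + 300 * \<beta> (K + n + 2)) * A n" for n
  proof -
    have u2: "u (K + n + 2)
        = 2 *\<^sub>R x (K + n + 2) - x (K + n + 1) + \<beta> (K + n + 2) *\<^sub>R (x (K + n + 1) - u (K + n + 1))"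
      using u_Suc[of "K + n + 1"] by simp
    have proj_z: "inner (x (K + n + 2) - lam_inf *\<^sub>R B (u (K + n + 2)) - x (K + n + 3))
        (z - x (K + n + 3)) \<le> 0"
      using proj'[OF zC, of "n + 2"] by (simp add: numeral_3_eq_3)
    have proj_x: "inner (x (K + n + 1) - lam_inf *\<^sub>R B (u (K + n + 1)) - x (K + n + 2))
        (x j - x (K + n + 2)) \<le> 0" for j
      using proj'[OF xC, of "n + 1"] by simp
    have "A (Suc n) = energy z (B z) L lam_inf (x (K + n + 3)) (x (K + n + 2)) (u (K + n + 2))"
      by (simp add: A_def numeral_3_eq_3)
    also have "\<dots> \<le> (\<rho> + 300 * \<beta> (K + n + 2)) * A n"
      unfolding A_def \<rho>_def
      by (rule energy_step[OF u2 \<beta>0 \<beta>4 less_imp_le[OF inf(1)] less_imp_le[OF L] inf(2)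
          less_imp_le[OF \<sigma>(1)] inf(3) lip proj_z proj_x proj_x _ sol[OF xC] sol[OF xC]])
         (use \<sigma>(2) in \<open>simp add: strongly_monotone_def\<close>)
    finally show ?thesis .
  qed
  have A_ge: "(norm (x (K + n + 2) - z))\<^sup>2 \<le> A n" for n
    using inf L sol[OF xC] by (simp add: A_def energy_def)
  then have A_pos: "0 \<le> A n" for n
    using order_trans zero_le_power2 by blast
  define s where "s = (\<Sum>k. \<beta> k)"
  have s_ge: "(\<Sum>i<n. \<beta> (K + i + 2)) \<le> s" for n
  proof -
    have "(\<Sum>i<n. \<beta> (K + i + 2)) = sum \<beta> ((\<lambda>i. K + i + 2) ` {..<n})"
      by (simp add: sum.reindex inj_on_def)
    also have "\<dots> \<le> s"
      unfolding s_def using \<beta> by (intro sum_le_suminf) auto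
    finally show ?thesis .
  qed
  have e1: "1 \<le> exp (310 * s)"
    using s_ge[of 0] by simp
  have \<rho>2: "7 / 8 \<le> \<rho>\<^sup>2"
    using power_mono[OF \<rho>, of 2] by (simp add: power2_eq_square)
  have "(norm (x (K + m) - z))\<^sup>2 \<le> 200 * a * exp (310 * s) * \<rho> ^ m" for m
  proof -
    \<comment> \<open>The indices \<open>K\<close> and \<open>K + 1\<close> precede the recursion
      and are bounded directly by \<open>a\<close>.\<close>
    consider "m = 0" | "m = 1" | n where "m = n + 2"
      by (metis One_nat_def Suc_1 add_2_eq_Suc' not0_implies_Suc)
    then show ?thesis
    proof cases
      case 1
      have "a * 1 \<le> 200 * a * exp (310 * s)"
        using a0 e1 by (intro mult_mono) auto
      then show ?thesis
        using 1 sq_le(1) by simp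
    next
      case 2
      have "(norm (x (K + 1) - z))\<^sup>2 \<le> 4 * a"
        using power_mono[OF x1, of 2] R by (simp add: power_mult_distrib)
      also have "\<dots> \<le> (200 * a * 1) * (31 / 32)"
        using a0 by simp
      also have "\<dots> \<le> (200 * a * exp (310 * s)) * \<rho>"
        using a0 e1 \<rho> by (intro mult_mono) auto
      finally show ?thesis
        using 2 by simp
    next
      case (3 n)
      have "(norm (x (K + m) - z))\<^sup>2 \<le> A n"
        using A_ge[of n] 3 by (simp add: add.assoc)
      also have "\<dots> \<le> A 0 * exp (310 * (\<Sum>i<n. \<beta> (K + i + 2))) * \<rho> ^ n"
        using \<beta>(1) by (intro perturbed_geometric_decay \<rho> A_pos A_step) auto
      \<comment> \<open>Starting two steps late costs a factor \<open>\<rho>\<^sup>2\<close>, which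
        is at least 7/8; 200 times 7/8 is 175, above 103.\<close>
      also have "\<dots> \<le> (103 * a) * exp (310 * s) * \<rho> ^ n"
        using A0 s_ge a0 \<rho> by (intro mult_right_mono mult_mono) auto
      also have "(103 * a) * exp (310 * s) * \<rho> ^ n \<le> (200 * a * exp (310 * s) * \<rho> ^ n) * \<rho>\<^sup>2"
      proof -
        define c where "c = a * exp (310 * s) * \<rho> ^ n"
        have "0 \<le> c"
          using a0 \<rho> by (simp add: c_def)
        then have "103 * c \<le> 200 * c * \<rho>\<^sup>2"
          using mult_left_mono[OF \<rho>2, of "200 * c"] by linarith
        then show ?thesis
          by (simp add: c_def mult.assoc)
      qed
      also have "\<dots> = 200 * a * exp (310 * s) * \<rho> ^ m"
        using 3 by (simp add: power2_eq_square)
      finally show ?thesis .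
    qed
  qed
  from this[of "k - K"] kK
  show "(norm (x k - z))\<^sup>2
      \<le> 200 * lyapunov B L z lam x u K * exp (310 * (\<Sum>k. \<beta> k)) * (1 - lam_inf * \<sigma>) ^ (k - K)"
    by (simp add: a_def s_def \<rho>_def)
qed

end
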